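(* The exponential generating function of the deranged Bell numbers $\tilde{F}_n$ is $$\sum_{n\ge 0}\tilde{F}_n\frac{t^n}{n!}=\frac{e^{-(e^t-1)}}{2-e^t}.$$
   Context: For $n\ge 0$ let $[n]=\{1,\dots,n\}$. A partition of $[n]$ into $k$ blocks is written $B_1|B_2|\cdots|B_k$, with non-empty disjoint blocks whose union is $[n]$, listed so that $\min B_1<\min B_2<\cdots<\min B_k$. A deranged partition of $[n]$ is an arrangement $B_{\sigma(1)}|B_{\sigma(2)}|\cdots|B_{\sigma(k)}$ of the blocks of some partition $B_1|\cdots|B_k$ of $[n]$, where $\sigma$ is a permutation of $[k]$ such that $B_{\sigma(i)}\neq B_i$ for all $1\le i\le k$ (i.e. $\sigma$ is a derangement). The deranged Bell number $\tilde{F}_n$ is the total number of deranged partitions of $[n]$ (over all $k$), with $\tilde{F}_0=1$. The identity is one of formal power series in $t$ (equivalently, of functions analytic near $t=0$). *)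

theory Defs
  imports
    "HOL-Library.Disjoint_Sets"
    "HOL-Combinatorics.Permutations"
    "HOL-Computational_Algebra.Formal_Power_Series"
begin

text \<open>The listing \<open>B\<^sub>1|...|B\<^sub>k\<close> of the blocks of a partition of \<open>{1..n}\<close> by increasing minima.
  Lists are indexed from 0, so \<open>B\<^sub>i\<close> is \<open>Bs ! (i - 1)\<close>.\<close>

definition partition_listing :: "nat \<Rightarrow> nat set list \<Rightarrow> bool" where
  "partition_listing n Bs \<longleftrightarrow>
     partition_on {1..n} (set Bs) \<and> distinct Bs \<and> sorted_wrt (<) (map Min Bs)"

definition deranged_partition :: "nat \<Rightarrow> nat set list \<Rightarrow> bool" where
  "deranged_partition n Cs \<longleftrightarrow>
     (\<exists>Bs \<sigma>. partition_listing n Bs \<and>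
        \<sigma> permutes {..<length Bs} \<and>
        (\<forall>i<length Bs. Bs ! \<sigma> i \<noteq> Bs ! i) \<and>
        Cs = map (\<lambda>i. Bs ! \<sigma> i) [0..<length Bs])"

definition deranged_bell :: "nat \<Rightarrow> nat" where
  "deranged_bell n = card {Cs. deranged_partition n Cs}"

text \<open>The set counted by \<open>deranged_bell n\<close> is finite, so \<open>card\<close> is its true size.\<close>

lemma finite_deranged_partitions: "finite {Cs. deranged_partition n Cs}"
proof (rule finite_subset)
  show "{Cs. deranged_partition n Cs} \<subseteq> {Cs. set Cs \<subseteq> Pow {1..n} \<and> distinct Cs}"
  proof safe
    fix Cs assume "deranged_partition n Cs"
    then obtain Bs \<sigma> where P: "partition_listing n Bs" and s: "\<sigma> permutes {..<length Bs}"
      and C: "Cs = map (\<lambda>i. Bs ! \<sigma> i) [0..<length Bs]"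
      unfolding deranged_partition_def by blast
    have lt: "\<sigma> i < length Bs" if "i < length Bs" for i
      using permutes_in_image[OF s, of i] that by simp
    have sub: "\<Union> (set Bs) = {1..n}" and d: "distinct Bs"
      using P by (auto simp: partition_listing_def partition_on_def)
    show "distinct Cs"
      using d lt permutes_inj[OF s]
      by (auto simp: C distinct_map inj_on_def nth_eq_iff_index_eq)
    fix X x assume "X \<in> set Cs" "x \<in> X"
    then have "x \<in> \<Union> (set Bs)" using lt by (auto simp: C)
    then show "x \<in> {1..n}" using sub by simp
  qed
  show "finite {Cs. set Cs \<subseteq> Pow {1..n} \<and> distinct Cs}"
    by (rule finite_subset_distinct) simp
qed

lemma deranged_bell_0: "deranged_bell 0 = 1"
proof -
  have "partition_listing 0 Bs \<longleftrightarrow> Bs = []" for Bs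
    by (cases Bs) (auto simp: partition_listing_def partition_on_def)
  then have "{Cs. deranged_partition 0 Cs} = {[]}"
    by (auto simp: deranged_partition_def)
  then show ?thesis by (simp add: deranged_bell_def)
qed

end

theory Submission imports Defs begin

text \<open>
  A deranged partition with \<open>k\<close> blocks is a partition into \<open>k\<close> blocks together with a
  derangement of \<open>k\<close> points: the blocks of the arrangement, sorted by their minima, recover the
  partition, and since the blocks are distinct, the positions then recover the permutation. With
  \<open>P n k\<close> partitions of \<open>{1..n}\<close> into \<open>k\<close> blocks and \<open>d k\<close> derangements of \<open>k\<close> points, this
  gives \<open>\<Sum>k\<le>n. P n k * d k\<close> deranged partitions (\<open>deranged_bell_eq_sum\<close>).

  Allowing all permutations instead of the derangements, the same correspondence
  yields every ordered partition of \<open>{1..n}\<close> into \<open>k\<close> blocks, that is, every surjection onto \<open>k\<close>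
  points; hence \<open>P n k\<close> is the number of surjections divided by \<open>k!\<close>
  (\<open>card_listings_mult_fact\<close>). For fixed \<open>k\<close> the exponential generating function of the
  surjections is \<open>(e\<^sup>t - 1)\<^sup>k\<close> (\<open>egf_surjections\<close>). Therefore the generating function
  of the deranged Bell numbers is \<open>\<Sum>k. d k / k! * (e\<^sup>t - 1)\<^sup>k\<close>: the one of the
  derangements with \<open>e\<^sup>t - 1\<close> substituted for its variable (\<open>egf_deranged_bell\<close>).
  Splitting off the fixed points of a permutation gives the classical \<open>e\<^bsup>-x\<^esup> / (1 - x)\<close>
  for the derangements (\<open>egf_derangements\<close>), and \<open>x = e\<^sup>t - 1\<close> turns it into the claimed
  quotient.
\<close>

unbundle fps_syntax

section \<open>Arrangements of blocks\<close>

definition listings :: "nat \<Rightarrow> nat \<Rightarrow> nat set list set" where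
  "listings n k = {Bs. partition_listing n Bs \<and> length Bs = k}"

definition derangements :: "'a set \<Rightarrow> ('a \<Rightarrow> 'a) set" where
  "derangements A = {\<pi>. \<pi> permutes A \<and> (\<forall>x\<in>A. \<pi> x \<noteq> x)}"

definition surjections :: "'a set \<Rightarrow> 'b set \<Rightarrow> ('a \<Rightarrow> 'b) set" where
  "surjections A B = {f \<in> A \<rightarrow>\<^sub>E B. f ` A = B}"

lemma Min_in_block:
  assumes "partition_on {1..n::nat} P" "B \<in> P"
  shows "Min B \<in> B"
proof -
  have "B \<subseteq> {1..n}" "B \<noteq> {}"
    using assms by (auto simp: partition_on_def)
  then show ?thesis
    by (metis Min_in finite_atLeastAtMost finite_subset)
qed

text \<open>The minimum of a block lies in the block, and blocks are disjoint, so the minimum names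
  the block. Sorting by minima is therefore a canonical way to list a partition.\<close>

lemma inj_on_Min_partition:
  assumes "partition_on {1..n::nat} P"
  shows "inj_on Min P"
proof (rule inj_onI)
  fix B C assume BC: "B \<in> P" "C \<in> P" "Min B = Min C"
  then have "Min B \<in> B \<inter> C"
    using Min_in_block[OF assms] by (metis IntI)
  then show "B = C"
    using assms BC by (auto simp: partition_on_def disjoint_def)
qed

lemma partition_listing_unique:
  assumes "partition_listing n Bs" "partition_listing n Cs" "set Bs = set Cs"
  shows "Bs = Cs"
proof (rule map_sorted_distinct_set_unique[where f = Min])
  show "inj_on Min (set Bs \<union> set Cs)"
    using assms inj_on_Min_partition[of n "set Cs"] by (simp add: partition_listing_def)
qed (use assms in \<open>auto simp: partition_listing_def strict_sorted_iff\<close>)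

lemma partition_listing_exists:
  assumes "partition_on {1..n} P"
  obtains Bs where "partition_listing n Bs" "set Bs = P"
proof -
  have "finite P"
    using assms finite_elements by blast
  obtain Ls where Ls: "set Ls = P" "distinct Ls"
    using finite_distinct_list[OF \<open>finite P\<close>] by blast
  have "partition_listing n (sort_key Min Ls)"
    using assms Ls inj_on_Min_partition[OF assms]
    by (simp add: partition_listing_def strict_sorted_iff distinct_map)
  with Ls that[of "sort_key Min Ls"] show thesis
    by simp
qed

text \<open>The minima of the blocks are distinct elements of \<open>{1..n}\<close>.\<close>

lemma length_partition_listing_le:
  assumes "partition_listing n Bs"
  shows "length Bs \<le> n"
proof -
  have P: "partition_on {1..n} (set Bs)" and "distinct Bs"
    using assms by (auto simp: partition_listing_def)
  have "Min ` set Bs \<subseteq> {1..n}"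
    using P Min_in_block[OF P] by (fastforce simp: partition_on_def)
  then have "card (Min ` set Bs) \<le> n"
    using card_mono[of "{1..n}"] by simp
  then show ?thesis
    using \<open>distinct Bs\<close> by (simp add: card_image inj_on_Min_partition[OF P] distinct_card)
qed

text \<open>A rearranged listing determines its set of blocks, hence the listing itself by uniqueness
  of the sorted order; as the blocks are distinct, it also determines where each one was moved.\<close>

lemma inj_on_permute_list:
  "inj_on (\<lambda>(Bs, \<sigma>). permute_list \<sigma> Bs) (listings n k \<times> {\<sigma>. \<sigma> permutes {..<k}})"
proof (rule inj_onI; clarsimp)
  fix Bs \<sigma> Cs \<tau>
  assume L: "Bs \<in> listings n k" "Cs \<in> listings n k"
    and p: "\<sigma> permutes {..<k}" "\<tau> permutes {..<k}"
    and eq: "permute_list \<sigma> Bs = permute_list \<tau> Cs"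
  have len: "length Bs = k" "length Cs = k" and pl: "partition_listing n Bs" "partition_listing n Cs"
    using L by (auto simp: listings_def)
  have "set Bs = set Cs"
    using arg_cong[OF eq, of set] p len by simp
  then have [simp]: "Cs = Bs"
    using partition_listing_unique pl by blast
  have "distinct Bs"
    using pl by (simp add: partition_listing_def)
  have "\<sigma> i = \<tau> i" for i
  proof (cases "i < k")
    case True
    then have "\<sigma> i < k" "\<tau> i < k"
      using p permutes_in_image[of _ "{..<k}"] by auto
    moreover have "Bs ! \<sigma> i = Bs ! \<tau> i"
      using arg_cong[OF eq, of "\<lambda>xs. xs ! i"] p len True by (simp add: permute_list_nth)
    ultimately show ?thesis
      using \<open>distinct Bs\<close> len by (simp add: nth_eq_iff_index_eq)
  next
    case False
    then show ?thesis using p by (simp add: permutes_not_in)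
  qed
  then show "Bs = Cs \<and> \<sigma> = \<tau>"
    by auto
qed

text \<open>Every ordered partition is a rearrangement of its sorted version, so running over all
  permutations produces exactly the ordered partitions into \<open>k\<close> blocks.\<close>

lemma permuted_listings:
  "(\<lambda>(Bs, \<sigma>). permute_list \<sigma> Bs) ` (listings n k \<times> {\<sigma>. \<sigma> permutes {..<k}})
     = {Cs. partition_on {1..n} (set Cs) \<and> distinct Cs \<and> length Cs = k}" (is "?L = ?R")
proof (rule antisym)
  show "?L \<subseteq> ?R"
    by (auto simp: listings_def partition_listing_def)
  show "?R \<subseteq> ?L"
  proof
    fix Cs assume Cs: "Cs \<in> ?R"
    then obtain Bs where Bs: "partition_listing n Bs" "set Bs = set Cs"
      using partition_listing_exists by blast
    then have "mset Cs = mset Bs"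
      using Cs by (metis (no_types, lifting) mem_Collect_eq partition_listing_def set_eq_iff_mset_eq_distinct)
    then obtain \<sigma> where "\<sigma> permutes {..<length Bs}" "permute_list \<sigma> Bs = Cs"
      using mset_eq_permutation by blast
    moreover have "length Bs = k"
      using mset_eq_length[OF \<open>mset Cs = mset Bs\<close>] Cs by simp
    ultimately show "Cs \<in> ?L"
      using Bs by (force simp: listings_def)
  qed
qed

text \<open>The fibres of a surjection onto \<open>{..<k}\<close>, in the order of their values, form an ordered
  partition; conversely a list of blocks defines the map that sends each element to the index of
  its block. Surjectivity corresponds to the blocks being non-empty.\<close>

lemma bij_betw_surjections_ordered_partitions:
  "bij_betw (\<lambda>f. map (\<lambda>i. {x \<in> A. f x = i}) [0..<k]) (surjections A {..<k})
     {Cs. partition_on A (set Cs) \<and> distinct Cs \<and> length Cs = k}"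
  (is "bij_betw ?F _ ?R")
proof (rule bij_betw_imageI)
  show "inj_on ?F (surjections A {..<k})"
  proof (rule inj_onI)
    fix f g assume f: "f \<in> surjections A {..<k}" and g: "g \<in> surjections A {..<k}"
      and eq: "?F f = ?F g"
    show "f = g"
    proof (rule extensionalityI[of _ A])
      show "f x = g x" if "x \<in> A" for x
      proof -
        have "f x < k" using f that by (auto simp: surjections_def)
        then have "{y \<in> A. f y = f x} = {y \<in> A. g y = f x}"
          using arg_cong[OF eq, of "\<lambda>xs. xs ! f x"] by simp
        then have "x \<in> {y \<in> A. g y = f x}"
          using that by blast
        then show ?thesis by simp
      qed
    qed (use f g in \<open>auto simp: surjections_def PiE_def\<close>)
  qed
  show "?F ` surjections A {..<k} = ?R"
  proof (intro equalityI subsetI)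
    fix Cs assume "Cs \<in> ?F ` surjections A {..<k}"
    then obtain f where f: "f ` A = {..<k}" and Cs: "Cs = ?F f"
      by (auto simp: surjections_def)
    have ne: "\<exists>x\<in>A. f x = i" if "i < k" for i
      using f that by (metis imageE lessThan_iff)
    have "distinct Cs"
    proof -
      have "i = j" if "i < k" "{x \<in> A. f x = i} = {x \<in> A. f x = j}" for i j
        using ne[OF that(1)] that(2) by blast
      then show ?thesis
        unfolding Cs by (auto simp: distinct_map inj_on_def)
    qed
    moreover have "partition_on A (set Cs)"
    proof (rule partition_onI)
      show "\<Union> (set Cs) = A" using f unfolding Cs by auto
      show "{} \<notin> set Cs" using ne unfolding Cs by fastforce
    qed (auto simp: Cs disjnt_def)
    ultimately show "Cs \<in> ?R" by (simp add: Cs)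
  next
    fix Cs assume "Cs \<in> ?R"
    then have P: "partition_on A (set Cs)" and d: "distinct Cs" and l: "length Cs = k"
      by auto
    have ex: "\<exists>i<k. x \<in> Cs ! i" if "x \<in> A" for x
      using that P l by (auto simp: partition_on_def in_set_conv_nth)
    \<comment> \<open>Disjointness of the blocks makes the block index of an element unique.\<close>
    have un: "i = j" if "i < k" "j < k" "x \<in> Cs ! i" "x \<in> Cs ! j" for i j x
      using that P d l
      by (metis IntI disjointD empty_iff nth_eq_iff_index_eq nth_mem partition_onD2)
    define f where "f = (\<lambda>x\<in>A. THE i. i < k \<and> x \<in> Cs ! i)"
    have f: "f x < k \<and> x \<in> Cs ! f x" if "x \<in> A" for x
    proof -
      have "\<exists>!i. i < k \<and> x \<in> Cs ! i" using ex[OF that] un by blast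
      from theI'[OF this] show ?thesis using that by (simp add: f_def)
    qed
    have blk: "{x \<in> A. f x = i} = Cs ! i" if "i < k" for i
    proof -
      have "Cs ! i \<subseteq> A" using P l that by (auto simp: partition_on_def)
      then show ?thesis using f un[OF that] that by blast
    qed
    have "Cs ! i \<noteq> {}" if "i < k" for i
      using P l that by (metis nth_mem partition_onD3)
    then have "f ` A = {..<k}"
      using f blk by (fastforce simp: image_iff)
    then have "f \<in> surjections A {..<k}"
      by (auto simp: surjections_def f_def)
    moreover have "?F f = Cs"
      using blk l by (intro nth_equalityI) auto
    ultimately show "Cs \<in> ?F ` surjections A {..<k}" by force
  qed
qed

text \<open>Both sides count the ordered partitions of \<open>{1..n}\<close> into \<open>k\<close> blocks. The quotient
  of the right side by \<open>k!\<close> is the Stirling number of the second kind.\<close>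

lemma card_listings_mult_fact:
  "card (listings n k) * fact k = card (surjections {1..n} {..<k})"
proof -
  have "card (listings n k) * fact k = card (listings n k \<times> {\<sigma>. \<sigma> permutes {..<k}})"
    by (simp add: card_cartesian_product card_permutations)
  also have "\<dots> = card {Cs. partition_on {1..n} (set Cs) \<and> distinct Cs \<and> length Cs = k}"
    unfolding permuted_listings[symmetric] by (rule card_image[OF inj_on_permute_list, symmetric])
  also have "\<dots> = card (surjections {1..n} {..<k})"
    by (rule bij_betw_same_card[OF bij_betw_surjections_ordered_partitions, symmetric])
  finally show ?thesis .
qed

text \<open>Since the blocks are distinct, requiring that no position keeps its block is the same as
  requiring that the permutation has no fixed point.\<close>

lemma deranged_partitions_by_length:
  "{Cs. deranged_partition n Cs \<and> length Cs = k} =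
     (\<lambda>(Bs, \<sigma>). permute_list \<sigma> Bs) ` (listings n k \<times> derangements {..<k})"
proof -
  have fixes_iff: "Bs ! \<sigma> i \<noteq> Bs ! i \<longleftrightarrow> \<sigma> i \<noteq> i"
    if "partition_listing n Bs" "\<sigma> permutes {..<length Bs}" "i < length Bs" for Bs \<sigma> i
  proof -
    have "\<sigma> i < length Bs"
      using that permutes_in_image[of \<sigma> "{..<length Bs}" i] by simp
    then show ?thesis
      using that by (simp add: partition_listing_def nth_eq_iff_index_eq)
  qed
  have "deranged_partition n Cs \<longleftrightarrow>
      (\<exists>Bs \<sigma>. partition_listing n Bs \<and> \<sigma> \<in> derangements {..<length Bs} \<and>
         Cs = permute_list \<sigma> Bs)" for Cs
    unfolding deranged_partition_def derangements_def permute_list_def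
    by (intro ex_cong1) (use fixes_iff in blast)
  then show ?thesis
    by (fastforce simp: listings_def)
qed

lemma deranged_bell_eq_sum:
  "deranged_bell n = (\<Sum>k\<le>n. card (listings n k) * card (derangements {..<k}))"
proof -
  have len: "length Cs \<le> n" if "deranged_partition n Cs" for Cs
    using that by (auto simp: deranged_partition_def length_partition_listing_le)
  have "{Cs. deranged_partition n Cs} = (\<Union>k\<le>n. {Cs. deranged_partition n Cs \<and> length Cs = k})"
    using len by auto
  also have "card \<dots> = (\<Sum>k\<le>n. card {Cs. deranged_partition n Cs \<and> length Cs = k})"
    by (rule card_UN_disjoint) (auto intro: finite_subset[OF _ finite_deranged_partitions])
  also have "\<dots> = (\<Sum>k\<le>n. card (listings n k \<times> derangements {..<k}))"
    unfolding deranged_partitions_by_length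
    by (intro sum.cong refl card_image inj_on_subset[OF inj_on_permute_list])
       (auto simp: derangements_def)
  finally show ?thesis
    by (simp add: deranged_bell_def card_cartesian_product)
qed

section \<open>Surjections\<close>

text \<open>Surjections and derangements are both counted by sorting a larger family according to a
  subset (the image, or the set of moved points) whose cardinality alone matters. This identity
  then turns the sum over subsets into a binomial sum.\<close>

lemma sum_Pow_card:
  fixes f :: "nat \<Rightarrow> 'b::semiring_1"
  assumes "finite A"
  shows "(\<Sum>T\<in>Pow A. f (card T)) = (\<Sum>j\<le>card A. of_nat (card A choose j) * f j)"
proof -
  have "(\<Sum>T\<in>Pow A. f (card T)) = (\<Sum>j\<le>card A. \<Sum>T | T \<in> Pow A \<and> card T = j. f (card T))"
    by (rule sum.group[symmetric]) (use assms in \<open>auto intro: card_mono\<close>)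
  also have "\<dots> = (\<Sum>j\<le>card A. of_nat (card A choose j) * f j)"
    using assms by (intro sum.cong refl) (simp add: n_subsets)
  finally show ?thesis .
qed

lemma surjections_apply_notin: "f \<in> surjections A B \<Longrightarrow> x \<notin> A \<Longrightarrow> f x = undefined"
  by (auto simp: surjections_def PiE_def extensional_def)

lemma card_surjections_cong:
  assumes "bij_betw h B C"
  shows "card (surjections A B) = card (surjections A C)"
proof -
  have "bij_betw (\<lambda>f. \<lambda>x\<in>A. h (f x)) (surjections A B) (surjections A C)"
  proof (rule bij_betw_byWitness[where f' = "\<lambda>f. \<lambda>x\<in>A. inv_into B h (f x)"])
    have h: "bij_betw h B C" "inj_on h B" "h ` B = C" using assms by (auto simp: bij_betw_def)
    show "\<forall>f\<in>surjections A B. (\<lambda>x\<in>A. inv_into B h ((\<lambda>x\<in>A. h (f x)) x)) = f"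
    proof (intro ballI ext)
      fix f x assume "f \<in> surjections A B"
      moreover from this have "f x \<in> B" if "x \<in> A"
        using that by (auto simp: surjections_def)
      ultimately show "(\<lambda>x\<in>A. inv_into B h ((\<lambda>x\<in>A. h (f x)) x)) x = f x"
        using h(2) by (cases "x \<in> A") (simp_all add: surjections_apply_notin[of f])
    qed
    show "\<forall>f\<in>surjections A C. (\<lambda>x\<in>A. h ((\<lambda>x\<in>A. inv_into B h (f x)) x)) = f"
    proof (intro ballI ext)
      fix f x assume "f \<in> surjections A C"
      moreover from this have "f x \<in> h ` B" if "x \<in> A"
        using that h(3) by (auto simp: surjections_def)
      ultimately show "(\<lambda>x\<in>A. h ((\<lambda>x\<in>A. inv_into B h (f x)) x)) x = f x"
        by (cases "x \<in> A") (simp_all add: surjections_apply_notin[of f] f_inv_into_f)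
    qed
    have "(\<lambda>x. h (f x)) ` A = h ` (f ` A)" for f by auto
    then show "(\<lambda>f. \<lambda>x\<in>A. h (f x)) ` surjections A B \<subseteq> surjections A C"
      using h by (auto simp: surjections_def)
    have "(\<lambda>x. inv_into B h (f x)) ` A = inv_into B h ` (f ` A)" for f by auto
    moreover have "inv_into B h ` C = B"
      using h by (simp add: bij_betw_imp_surj_on bij_betw_inv_into)
    ultimately show "(\<lambda>f. \<lambda>x\<in>A. inv_into B h (f x)) ` surjections A C \<subseteq> surjections A B"
      by (auto simp: surjections_def)
  qed
  then show ?thesis by (rule bij_betw_same_card)
qed

text \<open>Every map from \<open>A\<close> to \<open>{..<k}\<close> is a surjection onto its image, and the number of
  surjections onto a set depends only on its size.\<close>

lemma power_eq_sum_surjections: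
  assumes "finite A"
  shows "k ^ card A = (\<Sum>j\<le>k. (k choose j) * card (surjections A {..<j}))"
proof -
  have fin: "finite (A \<rightarrow>\<^sub>E {..<k})"
    using assms by (intro finite_PiE) auto
  have eq: "A \<rightarrow>\<^sub>E {..<k} = (\<Union>T\<in>Pow {..<k}. surjections A T)"
    by (auto simp: surjections_def PiE_def Pi_def)
  have "k ^ card A = card (A \<rightarrow>\<^sub>E {..<k})"
    using assms by (simp add: card_funcsetE)
  also have "\<dots> = (\<Sum>T\<in>Pow {..<k}. card (surjections A T))"
    unfolding eq
    by (rule card_UN_disjoint)
       (use fin eq in \<open>auto intro: finite_subset simp: surjections_def\<close>)
  also have "\<dots> = (\<Sum>T\<in>Pow {..<k}. card (surjections A {..<card T}))"
  proof (rule sum.cong[OF refl])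
    fix T assume "T \<in> Pow {..<k}"
    then have "finite T" by (auto intro: finite_subset)
    then obtain h where "bij_betw h T {..<card T}"
      using ex_bij_betw_finite_nat by (auto simp: atLeast0LessThan)
    then show "card (surjections A T) = card (surjections A {..<card T})"
      by (rule card_surjections_cong)
  qed
  finally show ?thesis
    using sum_Pow_card[of "{..<k}" "\<lambda>j. card (surjections A {..<j})"] by simp
qed

text \<open>The transform is triangular with the coefficient \<open>k choose k = 1\<close> on the diagonal, so it
  can be undone one term at a time.\<close>

lemma binomial_transform_inj:
  fixes f g :: "nat \<Rightarrow> 'a::ring_1"
  assumes "\<And>k. (\<Sum>j\<le>k. of_nat (k choose j) * f j) = (\<Sum>j\<le>k. of_nat (k choose j) * g j)"
  shows "f k = g k"
proof (induction k rule: less_induct)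
  case (less k)
  have "(\<Sum>j<k. of_nat (k choose j) * f j) = (\<Sum>j<k. of_nat (k choose j) * g j)"
    using less by (intro sum.cong) auto
  with assms[of k] show ?case
    by (simp add: lessThan_Suc_atMost[symmetric])
qed

text \<open>By \<open>power_eq_sum_surjections\<close> the series on the left have binomial transform \<open>e\<^bsup>kt\<^esup>\<close>.
  The powers of \<open>e\<^sup>t - 1\<close> have the same transform, by the binomial theorem for
  \<open>((e\<^sup>t - 1) + 1)\<^sup>k\<close>, and the transform is injective.\<close>

lemma egf_surjections:
  "Abs_fps (\<lambda>n. of_nat (card (surjections {1..n} {..<k})) / fact n :: real) = (fps_exp 1 - 1) ^ k"
proof (rule binomial_transform_inj)
  fix k
  let ?S = "\<lambda>k. Abs_fps (\<lambda>n. of_nat (card (surjections {1..n} {..<k})) / fact n :: real)"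
  have "(\<Sum>j\<le>k. of_nat (k choose j) * ?S j) = fps_exp (of_nat k)"
  proof (rule fps_ext)
    fix n
    have "(\<Sum>j\<le>k. of_nat (k choose j) * ?S j) $ n
        = (\<Sum>j\<le>k. real (k choose j) * (real (card (surjections {1..n} {..<j})) / fact n))"
      by (simp add: fps_sum_nth fps_of_nat[symmetric])
    also have "\<dots> = real (k ^ card {1..n}) / fact n"
      unfolding power_eq_sum_surjections[OF finite_atLeastAtMost] by (simp add: sum_divide_distrib)
    finally show "(\<Sum>j\<le>k. of_nat (k choose j) * ?S j) $ n = fps_exp (of_nat k) $ n"
      by simp
  qed
  also have "\<dots> = ((fps_exp 1 - 1) + 1) ^ k"
    by (simp add: fps_exp_power_mult)
  also have "\<dots> = (\<Sum>j\<le>k. of_nat (k choose j) * (fps_exp 1 - 1) ^ j)"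
    by (subst binomial_ring) simp
  finally show "(\<Sum>j\<le>k. of_nat (k choose j) * ?S j)
      = (\<Sum>j\<le>k. of_nat (k choose j) * (fps_exp 1 - 1) ^ j)" .
qed

section \<open>Derangements\<close>

lemma card_derangements_cong:
  assumes "bij_betw h A B"
  shows "card (derangements A) = card (derangements B)"
  unfolding derangements_def by (rule bij_betw_same_card[OF bij_betw_derangements[OF assms]])

text \<open>Every permutation is a derangement of the set of points that it moves.\<close>

lemma fact_eq_sum_derangements:
  "fact k = (\<Sum>j\<le>k. (k choose j) * card (derangements {..<j}))"
proof -
  have fin: "finite {\<pi>. \<pi> permutes {..<k}}"
    by (simp add: finite_permutations)
  have eq: "{\<pi>. \<pi> permutes {..<k}} = (\<Union>T\<in>Pow {..<k}. derangements T)"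
  proof (intro equalityI subsetI)
    fix \<pi> assume "\<pi> \<in> {\<pi>. \<pi> permutes {..<k}}"
    then have p: "\<pi> permutes {..<k}" by simp
    then have "\<pi> permutes {x \<in> {..<k}. \<pi> x \<noteq> x}"
      by (rule permutes_superset) auto
    then show "\<pi> \<in> (\<Union>T\<in>Pow {..<k}. derangements T)"
      by (auto simp: derangements_def intro!: bexI[of _ "{x \<in> {..<k}. \<pi> x \<noteq> x}"])
  qed (auto simp: derangements_def intro: permutes_subset)
  have disj: "S = T" if "\<pi> \<in> derangements S" "\<pi> \<in> derangements T" for \<pi> and S T :: "nat set"
    using that by (auto simp: derangements_def dest: permutes_not_in)
  have "fact k = card {\<pi>. \<pi> permutes {..<k}}"
    by (simp add: card_permutations)
  also have "\<dots> = (\<Sum>T\<in>Pow {..<k}. card (derangements T))"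
    unfolding eq
    by (rule card_UN_disjoint)
       (use disj fin eq in \<open>auto intro: finite_subset\<close>)
  also have "\<dots> = (\<Sum>T\<in>Pow {..<k}. card (derangements {..<card T}))"
  proof (rule sum.cong[OF refl])
    fix T assume "T \<in> Pow {..<k}"
    then have "finite T" by (auto intro: finite_subset)
    then obtain h where "bij_betw h T {..<card T}"
      using ex_bij_betw_finite_nat by (auto simp: atLeast0LessThan)
    then show "card (derangements T) = card (derangements {..<card T})"
      by (rule card_derangements_cong)
  qed
  finally show ?thesis
    using sum_Pow_card[of "{..<k}" "\<lambda>j. card (derangements {..<j})"] by simp
qed

text \<open>In terms of generating functions, \<open>fact_eq_sum_derangements\<close> says that multiplying the
  series of the derangements by \<open>e\<^sup>x\<close> gives the series of all permutations,
  \<open>\<Sum>k. x\<^sup>k = 1 / (1 - x)\<close>.\<close>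

lemma egf_derangements:
  "Abs_fps (\<lambda>k. of_nat (card (derangements {..<k})) / fact k :: real) * (1 - fps_X) = fps_exp (- 1)"
  (is "?D * _ = _")
proof -
  have "?D * fps_exp 1 = Abs_fps (\<lambda>_. 1)"
  proof (rule fps_ext)
    fix k
    have "(?D * fps_exp 1) $ k
        = (\<Sum>j\<le>k. real ((k choose j) * card (derangements {..<j})) / fact k)"
      by (auto simp: fps_mult_nth atLeast0AtMost binomial_fact intro!: sum.cong)
    also have "\<dots> = real (fact k) / fact k"
      unfolding fact_eq_sum_derangements[of k] of_nat_sum sum_divide_distrib ..
    finally show "(?D * fps_exp 1) $ k = Abs_fps (\<lambda>_. 1) $ k"
      by simp
  qed
  moreover have "Abs_fps (\<lambda>_. 1 :: real) * (1 - fps_X) = 1"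
    by (rule fps_ext) (simp add: algebra_simps)
  ultimately have "?D * fps_exp 1 * (1 - fps_X) = 1"
    by simp
  moreover have "?D * (1 - fps_X) * (fps_exp 1 * fps_exp (- 1))
      = (?D * fps_exp 1 * (1 - fps_X)) * fps_exp (- 1)"
    by (simp only: mult_ac)
  moreover have "fps_exp 1 * fps_exp (- 1) = (1 :: real fps)"
    by (simp flip: fps_exp_add_mult)
  ultimately show ?thesis by simp
qed

section \<open>The generating function\<close>

text \<open>The coefficient of \<open>t\<^sup>n\<close> in a composition is a sum over \<open>k \<le> n\<close>, because \<open>e\<^sup>t - 1\<close> has
  no constant term. By \<open>egf_surjections\<close> and \<open>card_listings_mult_fact\<close> its terms are those of
  \<open>deranged_bell_eq_sum\<close>, up to the factor \<open>1 / n!\<close>.\<close>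

lemma egf_deranged_bell:
  "Abs_fps (\<lambda>n. of_nat (deranged_bell n) / fact n :: real) =
     Abs_fps (\<lambda>k. of_nat (card (derangements {..<k})) / fact k) oo (fps_exp 1 - 1)"
proof (rule fps_ext)
  fix n
  have "real (card (listings n k)) = real (card (surjections {1..n} {..<k})) / fact k" for k
    unfolding card_listings_mult_fact[symmetric] by simp
  then have "real (deranged_bell n) / fact n
      = (\<Sum>k\<le>n. real (card (derangements {..<k})) / fact k
           * (real (card (surjections {1..n} {..<k})) / fact n))"
    by (simp add: deranged_bell_eq_sum sum_divide_distrib mult_ac)
  then show "Abs_fps (\<lambda>n. of_nat (deranged_bell n) / fact n :: real) $ n =
     (Abs_fps (\<lambda>k. of_nat (card (derangements {..<k})) / fact k) oo (fps_exp 1 - 1)) $ n"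
    by (simp add: fps_compose_nth atLeast0AtMost flip: egf_surjections)
qed

theorem theorem3p1:
  "Abs_fps (\<lambda>n. of_nat (deranged_bell n) / fact n :: real) =
     (fps_exp 1 oo (- (fps_exp 1 - 1))) / (2 - fps_exp 1)"
proof -
  let ?D = "Abs_fps (\<lambda>k. of_nat (card (derangements {..<k})) / fact k :: real)"
  let ?g = "fps_exp 1 - 1 :: real fps"
  have g0: "?g $ 0 = 0" by simp
  \<comment> \<open>Substitution respects products, so \<open>egf_derangements\<close> may be evaluated at \<open>e\<^sup>t - 1\<close>.\<close>
  have "(?D oo ?g) * (2 - fps_exp 1) = (?D oo ?g) * ((1 - fps_X) oo ?g)"
    by (simp add: fps_compose_sub_distrib)
  also have "\<dots> = fps_exp (- 1) oo ?g"
    by (simp add: egf_derangements flip: fps_compose_mult_distrib[OF g0])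
  also have "\<dots> = (fps_exp 1 oo (- fps_X)) oo ?g"
    by simp
  also have "\<dots> = fps_exp 1 oo (- ?g)"
    by (subst fps_compose_assoc[symmetric]) (simp_all add: fps_compose_uminus)
  finally have prod: "(?D oo ?g) * (2 - fps_exp 1) = fps_exp 1 oo (- ?g)" .
  have "(2 - fps_exp 1 :: real fps) \<noteq> 0"
  proof
    assume "(2 - fps_exp 1 :: real fps) = 0"
    then have "(2 - fps_exp 1 :: real fps) $ 0 = 0" by simp
    then show False by simp
  qed
  then show ?thesis
    unfolding egf_deranged_bell prod[symmetric] by (rule nonzero_mult_div_cancel_right[symmetric])
qed

end
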